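(* Suppose there is $\epsilon_0\in(0,1)$ with $\rho_0-\Lambda_2>\epsilon_0$, and there is $M>0$ such that all eigenvalues of $\Sigma_x$ and $\Sigma_y$ lie in $[M^{-1},M]$. Then the matrix $$H^0=2\rho_0\begin{bmatrix}\Sigma_x+2\Sigma_x\alpha_0\alpha_0^T\Sigma_x & -\Sigma_{xy}/\rho_0\\ -\Sigma_{yx}/\rho_0 & \Sigma_y+2\Sigma_y\beta_0\beta_0^T\Sigma_y\end{bmatrix}$$ is positive definite, and its minimum eigenvalue satisfies $\Lambda_{\min}(H^0)\ge 2(\rho_0-\Lambda_2)/M$.
   Context: $X\in\mathbb{R}^p$ and $Y\in\mathbb{R}^q$ are centered random vectors with joint covariance matrix $\Sigma=\begin{bmatrix}\Sigma_x&\Sigma_{xy}\\ \Sigma_{yx}&\Sigma_y\end{bmatrix}$, $\Sigma_{yx}=\Sigma_{xy}^T$. $\Sigma_{xy}$ has rank $r\ge 1$ and is decomposed as $\Sigma_{xy}=\Sigma_xU\Lambda V^T\Sigma_y$, where $U=[u_1\ \ldots\ u_r]\in\mathbb{R}^{p\times r}$, $V=[v_1\ \ldots\ v_r]\in\mathbb{R}^{q\times r}$ satisfy $U^T\Sigma_xU=V^T\Sigma_yV=I_r$, and $\Lambda=\mathrm{diag}(\Lambda_1,\ldots,\Lambda_r)$ with $\Lambda_1\ge\cdots\ge\Lambda_r>0$ (the canonical correlations). Write $\rho_0=\Lambda_1$, $\alpha_0=u_1$, $\beta_0=v_1$; convention $\Lambda_2=0$ if $r=1$. ($H^0$ is the Hessian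 at $(\rho_0^{1/2}\alpha_0,\rho_0^{1/2}\beta_0)$ of $h(x,y)=\frac12(x^T\Sigma_xx)^2+\frac12(y^T\Sigma_yy)^2-2x^T\Sigma_{xy}y$.) *)

theory Defs
  imports
    "HOL-Probability.Probability"
    "Jordan_Normal_Form.Spectral_Radius"
    "Jordan_Normal_Form.DL_Rank"
begin

text \<open>Vectors and matrices are those of Jordan Normal Form, so that the dimensions \<open>p\<close>, \<open>q\<close>
  and \<open>r\<close> are natural numbers and indices start at 0. The analysis library uses the same infix
  symbols for its own types.\<close>

no_notation Finite_Cartesian_Product.vec_nth (infixl \<open>$\<close> 90)
no_notation Inner_Product.real_inner_class.inner (infixl \<open>\<bullet>\<close> 70)

text \<open>Square integrability of the components is what makes all covariances below well defined.\<close>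

definition random_vector :: "'a measure \<Rightarrow> nat \<Rightarrow> ('a \<Rightarrow> real vec) \<Rightarrow> bool" where
  "random_vector P n Z \<longleftrightarrow>
     (\<forall>\<omega>\<in>space P. Z \<omega> \<in> carrier_vec n) \<and>
     (\<forall>i<n. (\<lambda>\<omega>. Z \<omega> $ i) \<in> borel_measurable P \<and> integrable P (\<lambda>\<omega>. (Z \<omega> $ i)\<^sup>2))"

definition mean_vec :: "'a measure \<Rightarrow> nat \<Rightarrow> ('a \<Rightarrow> real vec) \<Rightarrow> real vec" where
  "mean_vec P n Z = vec n (\<lambda>i. \<integral>\<omega>. Z \<omega> $ i \<partial>P)"

definition covariance_mat :: "'a measure \<Rightarrow> nat \<Rightarrow> ('a \<Rightarrow> real vec) \<Rightarrow> real mat" where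
  "covariance_mat P n Z =
     mat n n (\<lambda>(i, j).
       \<integral>\<omega>. (Z \<omega> $ i - mean_vec P n Z $ i) * (Z \<omega> $ j - mean_vec P n Z $ j) \<partial>P)"

definition outer_prod :: "real vec \<Rightarrow> real vec \<Rightarrow> real mat" where
  "outer_prod v w = mat (dim_vec v) (dim_vec w) (\<lambda>(i, j). v $ i * w $ j)"

definition positive_definite :: "real mat \<Rightarrow> bool" where
  "positive_definite A \<longleftrightarrow>
     square_mat A \<and> A\<^sup>T = A \<and>
     (\<forall>v\<in>carrier_vec (dim_row A). v \<noteq> 0\<^sub>v (dim_row A) \<longrightarrow> 0 < v \<bullet> (A *\<^sub>v v))"

text \<open>\<open>Min\<close> is only meaningful on a finite nonempty set; the (real) spectrum is one whenever
  the matrix is symmetric of positive dimension.\<close>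

definition min_eigenvalue :: "real mat \<Rightarrow> real" where
  "min_eigenvalue A = Min (spectrum A)"

text \<open>The closed form, for \<open>\<rho> = \<Lambda>\<^sub>1\<close>, \<open>\<alpha> = u\<^sub>1\<close>, \<open>\<beta> = v\<^sub>1\<close>, of the Hessian of
  \<open>(x\<^sup>T \<Sigma>x x)\<^sup>2 / 2 + (y\<^sup>T \<Sigma>y y)\<^sup>2 / 2 - 2 x\<^sup>T \<Sigma>xy y\<close> at \<open>(sqrt \<rho> \<alpha>, sqrt \<rho> \<beta>)\<close>, where
  \<open>\<alpha>\<^sup>T \<Sigma>x \<alpha> = \<beta>\<^sup>T \<Sigma>y \<beta> = 1\<close>.\<close>

definition hessian_H0 ::
  "real mat \<Rightarrow> real mat \<Rightarrow> real mat \<Rightarrow> real mat \<Rightarrow> real \<Rightarrow> real vec \<Rightarrow> real vec \<Rightarrow> real mat" where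
  "hessian_H0 \<Sigma>x \<Sigma>xy \<Sigma>yx \<Sigma>y \<rho> \<alpha> \<beta> =
     (2 * \<rho>) \<cdot>\<^sub>m four_block_mat
       (\<Sigma>x + 2 \<cdot>\<^sub>m (\<Sigma>x * outer_prod \<alpha> \<alpha> * \<Sigma>x))   (- ((1 / \<rho>) \<cdot>\<^sub>m \<Sigma>xy))
       (- ((1 / \<rho>) \<cdot>\<^sub>m \<Sigma>yx))   (\<Sigma>y + 2 \<cdot>\<^sub>m (\<Sigma>y * outer_prod \<beta> \<beta> * \<Sigma>y))"

end

theory Submission
  imports Defs
begin

text \<open>Write \<open>s\<^sub>i = u\<^sub>i\<^sup>T \<Sigma>x a\<close>, \<open>t\<^sub>i = v\<^sub>i\<^sup>T \<Sigma>y b\<close>, \<open>A = a\<^sup>T \<Sigma>x a\<close> and \<open>B = b\<^sup>T \<Sigma>y b\<close>. At \<open>(a, b)\<close>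
  the quadratic form of \<open>H\<^sup>0\<close> is
  \<open>2 \<rho> (A + 2 s\<^sub>1\<^sup>2 + B + 2 t\<^sub>1\<^sup>2) - 4 \<Sum>\<^sub>i \<Lambda>\<^sub>i s\<^sub>i t\<^sub>i\<close>. Bounding \<open>2 s\<^sub>i t\<^sub>i \<le> s\<^sub>i\<^sup>2 + t\<^sub>i\<^sup>2\<close>,
  using \<open>\<Lambda>\<^sub>i \<le> \<Lambda>\<^sub>2\<close> for \<open>i \<ge> 2\<close> and Bessel's inequalities \<open>\<Sum>\<^sub>i s\<^sub>i\<^sup>2 \<le> A\<close>, \<open>\<Sum>\<^sub>i t\<^sub>i\<^sup>2 \<le> B\<close>, it is at least
  \<open>2 (\<rho> - \<Lambda>\<^sub>2) (A + B)\<close>, and \<open>A + B \<ge> (\<bar>a\<bar>\<^sup>2 + \<bar>b\<bar>\<^sup>2) / M\<close> by the spectral bounds.\<close>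

unbundle no inner_syntax

section \<open>Scalar products and crude norm bounds for real vectors and matrices\<close>

lemma smult_mat_mult_vec:
  fixes A :: "'a :: comm_semiring_0 mat"
  assumes "A \<in> carrier_mat m n" "v \<in> carrier_vec n"
  shows "(c \<cdot>\<^sub>m A) *\<^sub>v v = c \<cdot>\<^sub>v (A *\<^sub>v v)"
  using assms by (intro eq_vecI) auto

lemma scalar_prod_self_nonneg: "0 \<le> v \<bullet> (v :: real vec)"
  by (simp add: scalar_prod_def sum_nonneg)

lemma scalar_prod_self_pos:
  fixes v :: "real vec"
  assumes "v \<in> carrier_vec n" "v \<noteq> 0\<^sub>v n"
  shows "0 < v \<bullet> v"
proof -
  obtain i where "i < n" "v $ i \<noteq> 0"
    using assms by (metis carrier_vecD eq_vecI index_zero_vec)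
  then have "0 < (\<Sum>i<n. v $ i * v $ i)"
    by (intro sum_pos2[of _ i]) (auto simp flip: power2_eq_square)
  then show ?thesis
    using assms(1) by (simp add: scalar_prod_def atLeast0LessThan)
qed

lemma scalar_prod_self_minus_smult:
  fixes v w :: "real vec"
  assumes "v \<in> carrier_vec n" "w \<in> carrier_vec n"
  shows "(v - c \<cdot>\<^sub>v w) \<bullet> (v - c \<cdot>\<^sub>v w) = v \<bullet> v - 2 * c * (v \<bullet> w) + c\<^sup>2 * (w \<bullet> w)"
  using assms
  by (simp add: minus_scalar_prod_distrib[of _ n] scalar_prod_minus_distrib[of _ n]
      comm_scalar_prod[of w n v] power2_eq_square algebra_simps)

text \<open>Cauchy-Schwarz applied to each row bounds the squared norm of the image by the squared
  Frobenius norm times \<open>v \<bullet> v\<close>. Only the existence of some constant matters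
  later.\<close>

lemma mult_mat_vec_bounded:
  fixes A :: "real mat"
  assumes A: "A \<in> carrier_mat m n"
  obtains C where "C > 0" "\<And>v. v \<in> carrier_vec n \<Longrightarrow> (A *\<^sub>v v) \<bullet> (A *\<^sub>v v) \<le> C * (v \<bullet> v)"
proof
  define C where "C = (\<Sum>i<m. row A i \<bullet> row A i)"
  \<comment> \<open>The Frobenius sum \<open>C\<close> vanishes for a zero matrix, so 1 is added to
    get a strictly positive constant.\<close>
  show "C + 1 > 0"
    by (auto simp: C_def intro!: add_nonneg_pos sum_nonneg scalar_prod_self_nonneg)
  fix v :: "real vec" assume v: "v \<in> carrier_vec n"
  have "(row A i \<bullet> v)\<^sup>2 \<le> (row A i \<bullet> row A i) * (v \<bullet> v)" if "i < m" for i
    using Cauchy_Schwarz_ineq_sum[of "\<lambda>j. row A i $ j" "\<lambda>j. v $ j" "{0..<n}"] A v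
    by (simp add: scalar_prod_def power2_eq_square)
  then have "(\<Sum>i<m. (row A i \<bullet> v)\<^sup>2) \<le> C * (v \<bullet> v)"
    unfolding C_def sum_distrib_right by (intro sum_mono) auto
  moreover have "(A *\<^sub>v v) \<bullet> (A *\<^sub>v v) = (\<Sum>i<m. (row A i \<bullet> v)\<^sup>2)"
    using A by (simp add: scalar_prod_def[of "A *\<^sub>v v"] power2_eq_square atLeast0LessThan)
  moreover have "0 \<le> v \<bullet> v" by (rule scalar_prod_self_nonneg)
  ultimately show "(A *\<^sub>v v) \<bullet> (A *\<^sub>v v) \<le> (C + 1) * (v \<bullet> v)"
    by (simp add: algebra_simps)
qed

text \<open>The squared norms of \<open>v - A v\<close> and \<open>v + A v\<close> are nonnegative.
  Expanding them bounds twice the absolute value of the form by the squared norms of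
  \<open>v\<close> and \<open>A v\<close>, and the latter is controlled by
  \<open>mult_mat_vec_bounded\<close>.\<close>

lemma quadratic_form_bounded:
  fixes A :: "real mat"
  assumes A: "A \<in> carrier_mat n n"
  obtains C where "C > 0" "\<And>v. v \<in> carrier_vec n \<Longrightarrow> \<bar>v \<bullet> (A *\<^sub>v v)\<bar> \<le> C * (v \<bullet> v)"
proof -
  obtain C where C: "C > 0" "\<And>v. v \<in> carrier_vec n \<Longrightarrow> (A *\<^sub>v v) \<bullet> (A *\<^sub>v v) \<le> C * (v \<bullet> v)"
    using mult_mat_vec_bounded[OF A] by blast
  show ?thesis
  proof
    show "(C + 1) / 2 > 0" using C(1) by simp
    fix v :: "real vec" assume v: "v \<in> carrier_vec n"
    have w: "A *\<^sub>v v \<in> carrier_vec n" using A v by simp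
    have "0 \<le> v \<bullet> v - 2 * c * (v \<bullet> (A *\<^sub>v v)) + c\<^sup>2 * ((A *\<^sub>v v) \<bullet> (A *\<^sub>v v))" for c :: real
      unfolding scalar_prod_self_minus_smult[OF v w, symmetric] by (rule scalar_prod_self_nonneg)
    from this[of 1] this[of "-1"] C(2)[OF v]
    show "\<bar>v \<bullet> (A *\<^sub>v v)\<bar> \<le> (C + 1) / 2 * (v \<bullet> v)"
      by (simp add: field_simps)
  qed
qed

section \<open>Symmetric matrices: quadratic forms, coercivity and the least eigenvalue\<close>

lemma symmetric_scalar_prod:
  fixes A :: "'a :: comm_semiring_0 mat"
  assumes "A \<in> carrier_mat n n" "A\<^sup>T = A" "v \<in> carrier_vec n" "w \<in> carrier_vec n"
  shows "v \<bullet> (A *\<^sub>v w) = (A *\<^sub>v v) \<bullet> w"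
  using transpose_vec_mult_scalar[of A n n w v] assms by simp

lemma symmetric_quadratic_form_minus:
  fixes A :: "real mat"
  assumes A: "A \<in> carrier_mat n n" "A\<^sup>T = A" and v: "v \<in> carrier_vec n" and w: "w \<in> carrier_vec n"
  shows "(v - w) \<bullet> (A *\<^sub>v (v - w)) = v \<bullet> (A *\<^sub>v v) - 2 * (w \<bullet> (A *\<^sub>v v)) + w \<bullet> (A *\<^sub>v w)"
proof -
  have [simp]: "A *\<^sub>v v \<in> carrier_vec n" "A *\<^sub>v w \<in> carrier_vec n" using A v w by auto
  have "v \<bullet> (A *\<^sub>v w) = w \<bullet> (A *\<^sub>v v)"
    using symmetric_scalar_prod[OF A v w] comm_scalar_prod[of "A *\<^sub>v v" n w] v w by simp
  then show ?thesis
    using v w A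
    by (simp add: minus_scalar_prod_distrib[of _ n] scalar_prod_minus_distrib[of _ n]
        mult_minus_distrib_mat_vec[of _ n n])
qed

text \<open>One gradient step: the form is nonnegative at \<open>v - (1 / C) B v\<close>, and
  expanding it there gives the claim once the quadratic term is bounded by \<open>C\<close>. No
  square root or diagonalization of \<open>B\<close> is involved.\<close>

lemma psd_mult_mat_vec_le:
  fixes B :: "real mat"
  assumes B: "B \<in> carrier_mat n n" "B\<^sup>T = B"
    and psd: "\<And>v. v \<in> carrier_vec n \<Longrightarrow> 0 \<le> v \<bullet> (B *\<^sub>v v)"
  obtains C where "C > 0"
    "\<And>v. v \<in> carrier_vec n \<Longrightarrow> (B *\<^sub>v v) \<bullet> (B *\<^sub>v v) \<le> C * (v \<bullet> (B *\<^sub>v v))"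
proof -
  obtain C where C: "C > 0" "\<And>v. v \<in> carrier_vec n \<Longrightarrow> \<bar>v \<bullet> (B *\<^sub>v v)\<bar> \<le> C * (v \<bullet> v)"
    using quadratic_form_bounded[OF B(1)] by blast
  show ?thesis
  proof (rule that[OF C(1)])
    fix v :: "real vec" assume v: "v \<in> carrier_vec n"
    define w where "w = B *\<^sub>v v"
    have w: "w \<in> carrier_vec n" using B v by (simp add: w_def)
    \<comment> \<open>The step length \<open>1 / C\<close> minimizes the upper bound
      \<open>- 2 * c * (w \<bullet> w) + c\<^sup>2 * C * (w \<bullet> w)\<close> over
      \<open>c\<close>.\<close>
    have "0 \<le> (v - (1 / C) \<cdot>\<^sub>v w) \<bullet> (B *\<^sub>v (v - (1 / C) \<cdot>\<^sub>v w))"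
      using v w by (intro psd) simp
    also have "\<dots> = v \<bullet> w - 2 / C * (w \<bullet> w) + 1 / C\<^sup>2 * (w \<bullet> (B *\<^sub>v w))"
      using symmetric_quadratic_form_minus[OF B v, of "(1 / C) \<cdot>\<^sub>v w"] w B v
      by (simp add: mult_mat_vec[of _ n n] power2_eq_square flip: w_def)
    also have "\<dots> \<le> v \<bullet> w - 2 / C * (w \<bullet> w) + 1 / C\<^sup>2 * (C * (w \<bullet> w))"
      using C(2)[OF w] by (intro add_left_mono mult_left_mono) auto
    also have "\<dots> = v \<bullet> w - (w \<bullet> w) / C"
      using C(1) by (simp add: power2_eq_square field_simps)
    finally show "(B *\<^sub>v v) \<bullet> (B *\<^sub>v v) \<le> C * (v \<bullet> (B *\<^sub>v v))"
      using C(1) by (simp add: field_simps flip: w_def)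
  qed
qed

text \<open>Injectivity gives a left inverse \<open>B'\<close>. Since \<open>v = B' (B v)\<close>,
  the norm of \<open>v\<close> is controlled by that of \<open>B v\<close>, which
  \<open>psd_mult_mat_vec_le\<close> in turn controls by the quadratic form itself.\<close>

lemma psd_injective_imp_coercive:
  fixes B :: "real mat"
  assumes B: "B \<in> carrier_mat n n" "B\<^sup>T = B"
    and psd: "\<And>v. v \<in> carrier_vec n \<Longrightarrow> 0 \<le> v \<bullet> (B *\<^sub>v v)"
    and inj: "\<And>v. v \<in> carrier_vec n \<Longrightarrow> B *\<^sub>v v = 0\<^sub>v n \<Longrightarrow> v = 0\<^sub>v n"
  obtains c where "c > 0" "\<And>v. v \<in> carrier_vec n \<Longrightarrow> c * (v \<bullet> v) \<le> v \<bullet> (B *\<^sub>v v)"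
proof -
  have "Determinant.det B \<noteq> 0"
    using det_0_iff_vec_prod_zero_field[OF B(1)] inj by blast
  then have "B \<in> Units (ring_mat TYPE(real) n ())"
    by (rule det_non_zero_imp_unit[OF B(1)])
  then obtain B' where B': "B' \<in> carrier_mat n n" "B' * B = 1\<^sub>m n"
    by (auto simp: Units_def ring_mat_def)
  obtain K where K: "K > 0" "\<And>v. v \<in> carrier_vec n \<Longrightarrow> (B' *\<^sub>v v) \<bullet> (B' *\<^sub>v v) \<le> K * (v \<bullet> v)"
    using mult_mat_vec_bounded[OF B'(1)] by blast
  obtain C where C: "C > 0"
    "\<And>v. v \<in> carrier_vec n \<Longrightarrow> (B *\<^sub>v v) \<bullet> (B *\<^sub>v v) \<le> C * (v \<bullet> (B *\<^sub>v v))"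
    using psd_mult_mat_vec_le[OF B psd] by blast
  show ?thesis
  proof
    show "1 / (K * C) > 0" using K C by simp
    fix v :: "real vec" assume v: "v \<in> carrier_vec n"
    have "v = B' *\<^sub>v (B *\<^sub>v v)"
      using assoc_mult_mat_vec[OF B'(1) B(1) v] B'(2) v by simp
    then have "v \<bullet> v \<le> K * ((B *\<^sub>v v) \<bullet> (B *\<^sub>v v))"
      using K(2)[of "B *\<^sub>v v"] B(1) v by simp
    also have "\<dots> \<le> K * (C * (v \<bullet> (B *\<^sub>v v)))"
      using C(2)[OF v] K(1) by simp
    finally show "1 / (K * C) * (v \<bullet> v) \<le> v \<bullet> (B *\<^sub>v v)"
      using K(1) C(1) by (simp add: field_simps)
  qed
qed

text \<open>The eigenvalue is the infimum \<open>k\<close> of the Rayleigh quotient: if \<open>A - k I\<close> were injective,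
  it would be coercive, and \<open>k\<close> could be increased.\<close>

lemma symmetric_least_eigenvalue:
  fixes A :: "real mat"
  assumes A: "A \<in> carrier_mat n n" "A\<^sup>T = A" and n: "n > 0"
  obtains k where "eigenvalue A k" "\<And>v. v \<in> carrier_vec n \<Longrightarrow> k * (v \<bullet> v) \<le> v \<bullet> (A *\<^sub>v v)"
proof -
  define S where "S = carrier_vec n - {0\<^sub>v n :: real vec}"
  define R where "R v = (v \<bullet> (A *\<^sub>v v)) / (v \<bullet> v)" for v
  define k where "k = (INF v\<in>S. R v)"
  have pos: "v \<bullet> v > 0" if "v \<in> S" for v
    using that scalar_prod_self_pos[of v n] by (simp add: S_def)
  \<comment> \<open>The infimum defining \<open>k\<close> is meaningful only for a nonempty set of
    values bounded below. The bound \<open>C\<close> supplies the latter; a unit vector, available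
    since \<open>n > 0\<close>, supplies the former.\<close>
  obtain C where C: "\<And>v. v \<in> carrier_vec n \<Longrightarrow> \<bar>v \<bullet> (A *\<^sub>v v)\<bar> \<le> C * (v \<bullet> v)"
    using quadratic_form_bounded[OF A(1)] by blast
  have "- C \<le> R v" if "v \<in> S" for v
    using C[of v] pos[OF that] that by (simp add: R_def S_def field_simps)
  then have bdd: "bdd_below (R ` S)"
    by (intro bdd_belowI2) auto
  have "unit_vec n 0 \<noteq> (0\<^sub>v n :: real vec)"
    using n by (metis index_unit_vec(2) index_zero_vec(1) zero_neq_one)
  then have ne: "S \<noteq> {}"
    unfolding S_def using unit_vec_carrier[of n 0] by blast
  have le: "k * (v \<bullet> v) \<le> v \<bullet> (A *\<^sub>v v)" if v: "v \<in> carrier_vec n" for v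
  proof (cases "v = 0\<^sub>v n")
    case True
    then show ?thesis using A by simp
  next
    case False
    then have "v \<in> S" using v by (simp add: S_def)
    then show ?thesis
      using cINF_lower[OF bdd, of v] pos[of v] by (simp add: k_def R_def field_simps)
  qed
  define B where "B = A - k \<cdot>\<^sub>m 1\<^sub>m n"
  have B: "B \<in> carrier_mat n n"
    unfolding B_def using A by (intro minus_carrier_mat smult_carrier_mat one_carrier_mat)
  have "B\<^sup>T = A\<^sup>T - k \<cdot>\<^sub>m 1\<^sub>m n"
    unfolding B_def using A(1) by (intro eq_matI) auto
  then have B_sym: "B\<^sup>T = B" by (simp add: A B_def)
  have Bv: "B *\<^sub>v v = A *\<^sub>v v - k \<cdot>\<^sub>v v" if "v \<in> carrier_vec n" for v
    using that A by (simp add: B_def minus_mult_distrib_mat_vec[of _ n n] smult_mat_mult_vec[of _ n n])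
  have vBv: "v \<bullet> (B *\<^sub>v v) = v \<bullet> (A *\<^sub>v v) - k * (v \<bullet> v)" if "v \<in> carrier_vec n" for v
    using that A by (simp add: Bv scalar_prod_minus_distrib[of _ n])
  have "\<exists>v\<in>carrier_vec n. v \<noteq> 0\<^sub>v n \<and> B *\<^sub>v v = 0\<^sub>v n"
  proof (rule ccontr)
    assume "\<not> ?thesis"
    then have inj: "v = 0\<^sub>v n" if "v \<in> carrier_vec n" "B *\<^sub>v v = 0\<^sub>v n" for v
      using that by blast
    have psd: "0 \<le> v \<bullet> (B *\<^sub>v v)" if "v \<in> carrier_vec n" for v
      using le[OF that] by (simp add: vBv[OF that])
    obtain c where c: "c > 0" "\<And>v. v \<in> carrier_vec n \<Longrightarrow> c * (v \<bullet> v) \<le> v \<bullet> (B *\<^sub>v v)"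
      using psd_injective_imp_coercive[OF B B_sym psd inj] by blast
    have "k + c \<le> R v" if "v \<in> S" for v
      using c(2)[of v] vBv[of v] pos[OF that] that by (simp add: R_def S_def field_simps)
    then have "k + c \<le> k"
      unfolding k_def by (intro cINF_greatest[OF ne]) (auto simp: k_def)
    then show False using c(1) by simp
  qed
  then obtain v where v: "v \<in> carrier_vec n" "v \<noteq> 0\<^sub>v n" "B *\<^sub>v v = 0\<^sub>v n" by blast
  have "A *\<^sub>v v = k \<cdot>\<^sub>v v"
  proof (intro eq_vecI)
    fix i assume "i < dim_vec (k \<cdot>\<^sub>v v)"
    then show "(A *\<^sub>v v) $ i = (k \<cdot>\<^sub>v v) $ i"
      using arg_cong[OF v(3)[unfolded Bv[OF v(1)]], of "\<lambda>u. u $ i"] v(1) A by simp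
  qed (use A v in auto)
  then have "eigenvalue A k"
    using v A by (auto simp: eigenvalue_def eigenvector_def)
  then show ?thesis using le by (rule that)
qed

text \<open>Each eigenvalue is the Rayleigh quotient at its own eigenvector, hence at least
  \<open>c\<close>. The spectrum is nonempty by \<open>symmetric_least_eigenvalue\<close>, so
  \<open>Min\<close> really picks an eigenvalue.\<close>

lemma symmetric_min_eigenvalue_ge:
  fixes H :: "real mat"
  assumes H: "H \<in> carrier_mat n n" "H\<^sup>T = H" and n: "n > 0"
    and ge: "\<And>v. v \<in> carrier_vec n \<Longrightarrow> c * (v \<bullet> v) \<le> v \<bullet> (H *\<^sub>v v)"
  shows "c \<le> min_eigenvalue H"
proof -
  have "finite (spectrum H)" by (rule card_finite_spectrum(1)[OF H(1)])
  moreover have "spectrum H \<noteq> {}"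
    using symmetric_least_eigenvalue[OF H n] by (auto simp: spectrum_def)
  moreover have "c \<le> k" if "k \<in> spectrum H" for k
  proof -
    obtain v where v: "v \<in> carrier_vec n" "v \<noteq> 0\<^sub>v n" "H *\<^sub>v v = k \<cdot>\<^sub>v v"
      using \<open>k \<in> spectrum H\<close> H(1) by (auto simp: spectrum_def eigenvalue_def eigenvector_def)
    then show ?thesis
      using ge[of v] scalar_prod_self_pos[of v n] by simp
  qed
  ultimately show ?thesis
    by (simp add: min_eigenvalue_def)
qed

lemma positive_definite_if_coercive:
  fixes H :: "real mat"
  assumes "H \<in> carrier_mat n n" "H\<^sup>T = H" "c > 0"
    and ge: "\<And>v. v \<in> carrier_vec n \<Longrightarrow> c * (v \<bullet> v) \<le> v \<bullet> (H *\<^sub>v v)"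
  shows "positive_definite H"
  unfolding positive_definite_def
proof (intro conjI ballI impI)
  fix v :: "real vec" assume v: "v \<in> carrier_vec (dim_row H)" "v \<noteq> 0\<^sub>v (dim_row H)"
  have "0 < c * (v \<bullet> v)"
    using scalar_prod_self_pos[OF v] \<open>c > 0\<close> by simp
  also have "\<dots> \<le> v \<bullet> (H *\<^sub>v v)"
    using v assms(1) by (intro ge) simp
  finally show "0 < v \<bullet> (H *\<^sub>v v)" .
qed (use assms in auto)

text \<open>Converts a spectral bound into a bound on the form by way of the least eigenvalue.
  Dimension 0 is separate: there is no eigenvalue then, but both sides are 0.\<close>

lemma symmetric_quadratic_form_ge:
  fixes A :: "real mat"
  assumes A: "A \<in> carrier_mat n n" "A\<^sup>T = A"
    and spec: "\<And>k. k \<in> spectrum A \<Longrightarrow> m \<le> k" and v: "v \<in> carrier_vec n"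
  shows "m * (v \<bullet> v) \<le> v \<bullet> (A *\<^sub>v v)"
proof (cases "n = 0")
  case True
  then show ?thesis using A v by (simp add: scalar_prod_def)
next
  case False
  then obtain k where k: "eigenvalue A k" "k * (v \<bullet> v) \<le> v \<bullet> (A *\<^sub>v v)"
    using symmetric_least_eigenvalue[OF A] v by blast
  have "m * (v \<bullet> v) \<le> k * (v \<bullet> v)"
    using spec[of k] k(1) by (intro mult_right_mono scalar_prod_self_nonneg) (simp add: spectrum_def)
  then show ?thesis using k(2) by simp
qed

section \<open>Bessel's inequality, rank-one forms and the canonical decomposition in
  coordinates\<close>

lemma weighted_Bessel:
  fixes S U :: "real mat"
  assumes S: "S \<in> carrier_mat n n" "S\<^sup>T = S"
    and psd: "\<And>v. v \<in> carrier_vec n \<Longrightarrow> 0 \<le> v \<bullet> (S *\<^sub>v v)"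
    and U: "U \<in> carrier_mat n r" and orth: "U\<^sup>T * S * U = 1\<^sub>m r" and a: "a \<in> carrier_vec n"
  shows "(\<Sum>i<r. (col U i \<bullet> (S *\<^sub>v a))\<^sup>2) \<le> a \<bullet> (S *\<^sub>v a)"
proof -
  \<comment> \<open>The columns of \<open>U\<close> are orthonormal for the form of
    \<open>S\<close>, and \<open>s\<close> holds the coefficients of \<open>a\<close> along them.
    Thus \<open>U s\<close> is the projection of \<open>a\<close> onto their span, and the claim is
    that the residual \<open>a - U s\<close> has nonnegative form.\<close>
  define s where "s = U\<^sup>T *\<^sub>v (S *\<^sub>v a)"
  have s: "s \<in> carrier_vec r" using U by (intro carrier_vecI) (simp add: s_def)
  have Us: "U *\<^sub>v s \<in> carrier_vec n" using U s by simp
  have adj: "(U *\<^sub>v s) \<bullet> w = s \<bullet> (U\<^sup>T *\<^sub>v w)" if "w \<in> carrier_vec n" for w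
    using transpose_vec_mult_scalar[of "U\<^sup>T" r n w s] U s that by simp
  have "U\<^sup>T *\<^sub>v (S *\<^sub>v (U *\<^sub>v s)) = (U\<^sup>T * S * U) *\<^sub>v s"
    using U S(1) s by (simp add: assoc_mult_mat_vec[of _ r n _ r] assoc_mult_mat_vec[of _ r n _ n])
  then have "(U *\<^sub>v s) \<bullet> (S *\<^sub>v (U *\<^sub>v s)) = s \<bullet> s"
    using adj[of "S *\<^sub>v (U *\<^sub>v s)"] S(1) Us orth s by simp
  moreover have "(U *\<^sub>v s) \<bullet> (S *\<^sub>v a) = s \<bullet> s"
    using adj[of "S *\<^sub>v a"] S(1) a by (simp add: s_def)
  moreover have "0 \<le> (a - U *\<^sub>v s) \<bullet> (S *\<^sub>v (a - U *\<^sub>v s))"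
    using a Us by (intro psd) simp
  ultimately have "s \<bullet> s \<le> a \<bullet> (S *\<^sub>v a)"
    by (simp add: symmetric_quadratic_form_minus[OF S a Us])
  moreover have "s \<bullet> s = (\<Sum>i<r. (col U i \<bullet> (S *\<^sub>v a))\<^sup>2)"
    using U by (simp add: s_def scalar_prod_def[of s s] power2_eq_square atLeast0LessThan
        scalar_prod_def[of "U\<^sup>T *\<^sub>v (S *\<^sub>v a)" "U\<^sup>T *\<^sub>v (S *\<^sub>v a)"])
  ultimately show ?thesis by simp
qed

lemma outer_prod_carrier_mat:
  "x \<in> carrier_vec m \<Longrightarrow> y \<in> carrier_vec n \<Longrightarrow> outer_prod x y \<in> carrier_mat m n"
  by (simp add: outer_prod_def)

lemma conjugated_outer_prod_carrier_mat:
  assumes "S \<in> carrier_mat n n" "x \<in> carrier_vec n"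
  shows "S * outer_prod x x * S \<in> carrier_mat n n"
  using assms by (meson mult_carrier_mat outer_prod_carrier_mat)

text \<open>By symmetry the left factor \<open>S\<close> moves onto \<open>a\<close>, which leaves
  the form of the rank-one matrix \<open>outer_prod x x\<close> at \<open>S a\<close>.\<close>

lemma outer_prod_quadratic_form:
  assumes S: "S \<in> carrier_mat n n" "S\<^sup>T = S" and x: "x \<in> carrier_vec n" and a: "a \<in> carrier_vec n"
  shows "a \<bullet> ((S * outer_prod x x * S) *\<^sub>v a) = (x \<bullet> (S *\<^sub>v a))\<^sup>2"
proof -
  define w where "w = S *\<^sub>v a"
  have w: "w \<in> carrier_vec n" using S a by (simp add: w_def)
  have O: "outer_prod x x \<in> carrier_mat n n" using x by (simp add: outer_prod_carrier_mat)
  have Ow: "outer_prod x x *\<^sub>v w = (x \<bullet> w) \<cdot>\<^sub>v x"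
    using x w
    by (intro eq_vecI) (auto simp: outer_prod_def scalar_prod_def sum_distrib_left mult_ac intro!: sum.cong)
  have "a \<bullet> ((S * outer_prod x x * S) *\<^sub>v a) = a \<bullet> (S *\<^sub>v (outer_prod x x *\<^sub>v w))"
    using S O a by (simp add: w_def assoc_mult_mat_vec[of _ n n _ n])
  also have "\<dots> = w \<bullet> ((x \<bullet> w) \<cdot>\<^sub>v x)"
    using symmetric_scalar_prod[OF S a, of "(x \<bullet> w) \<cdot>\<^sub>v x"] x by (simp add: Ow flip: w_def)
  also have "\<dots> = (x \<bullet> w)\<^sup>2"
    using x w comm_scalar_prod[OF x w] by (simp add: power2_eq_square)
  finally show ?thesis by (simp add: w_def)
qed

text \<open>In canonical coordinates the cross-covariance is diagonal. The right half of the product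
  sends \<open>b\<close> to its coordinates scaled by \<Lambda>; the left half moves onto
  \<open>a\<close> by the symmetry of \<Sigma>x and the adjoint of \<open>U\<close>.\<close>

lemma canonical_decomposition_bilinear_form:
  fixes \<Sigma>x \<Sigma>y U V :: "real mat"
  assumes \<Sigma>x: "\<Sigma>x \<in> carrier_mat p p" "\<Sigma>x\<^sup>T = \<Sigma>x" and \<Sigma>y: "\<Sigma>y \<in> carrier_mat q q"
    and U: "U \<in> carrier_mat p r" and V: "V \<in> carrier_mat q r"
    and a: "a \<in> carrier_vec p" and b: "b \<in> carrier_vec q"
  shows "a \<bullet> ((\<Sigma>x * U * mat_diag r \<Lambda> * V\<^sup>T * \<Sigma>y) *\<^sub>v b) =
    (\<Sum>i<r. \<Lambda> i * (col U i \<bullet> (\<Sigma>x *\<^sub>v a)) * (col V i \<bullet> (\<Sigma>y *\<^sub>v b)))"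
proof -
  define t where "t = V\<^sup>T *\<^sub>v (\<Sigma>y *\<^sub>v b)"
  define d where "d = mat_diag r \<Lambda> *\<^sub>v t"
  have t: "t \<in> carrier_vec r" using V by (intro carrier_vecI) (simp add: t_def)
  have d: "d \<in> carrier_vec r" unfolding d_def by (rule mult_mat_vec_carrier[OF mat_diag_dim t])
  have "d $ i = \<Lambda> i * t $ i" if "i < r" for i
  proof -
    have "d $ i = (\<Sum>j\<in>{0..<r}. (if i = j then \<Lambda> j else 0) * t $ j)"
      using that t by (simp add: d_def mat_diag_def scalar_prod_def)
    also have "\<dots> = (\<Sum>j\<in>{0..<r}. if i = j then \<Lambda> j * t $ j else 0)"
      by (intro sum.cong) auto
    finally show ?thesis using that by simp
  qed
  then have d_nth: "d $ i = \<Lambda> i * (col V i \<bullet> (\<Sigma>y *\<^sub>v b))" if "i < r" for i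
    using that V by (simp add: t_def)
  have VT: "V\<^sup>T \<in> carrier_mat r q" and \<Sigma>yb: "\<Sigma>y *\<^sub>v b \<in> carrier_vec q"
    using V mult_mat_vec_carrier[OF \<Sigma>y b] by simp_all
  \<comment> \<open>The product is nested to the left. Carriers for its initial segments allow the
    factors to be applied to \<open>b\<close> one by one from the right.\<close>
  note C1 = mult_carrier_mat[OF \<Sigma>x(1) U]
  note C2 = mult_carrier_mat[OF C1 mat_diag_dim[of r \<Lambda>]]
  note C3 = mult_carrier_mat[OF C2 VT]
  have "(\<Sigma>x * U * mat_diag r \<Lambda> * V\<^sup>T * \<Sigma>y) *\<^sub>v b = \<Sigma>x *\<^sub>v (U *\<^sub>v d)"
    unfolding assoc_mult_mat_vec[OF C3 \<Sigma>y b] assoc_mult_mat_vec[OF C2 VT \<Sigma>yb] t_def[symmetric]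
      assoc_mult_mat_vec[OF C1 mat_diag_dim t] d_def[symmetric] assoc_mult_mat_vec[OF \<Sigma>x(1) U d] ..
  then have "a \<bullet> ((\<Sigma>x * U * mat_diag r \<Lambda> * V\<^sup>T * \<Sigma>y) *\<^sub>v b) = (\<Sigma>x *\<^sub>v a) \<bullet> (U *\<^sub>v d)"
    using symmetric_scalar_prod[OF \<Sigma>x a mult_mat_vec_carrier[OF U d]] by simp
  also have "\<dots> = (U\<^sup>T *\<^sub>v (\<Sigma>x *\<^sub>v a)) \<bullet> d"
    using transpose_vec_mult_scalar[OF U d, of "\<Sigma>x *\<^sub>v a"] \<Sigma>x a by simp
  also have "\<dots> = (\<Sum>i<r. (col U i \<bullet> (\<Sigma>x *\<^sub>v a)) * d $ i)"
    using U d by (simp add: scalar_prod_def[of "U\<^sup>T *\<^sub>v _"] atLeast0LessThan)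
  finally show ?thesis by (simp add: d_nth mult_ac)
qed

text \<open>Index 0 is kept apart because \<open>\<Lambda> 0\<close> may exceed \<open>l\<close>. On
  the tail every weight is at most \<open>l\<close>, and the bounds \<open>A\<close> and
  \<open>B\<close>, less their leading squares, absorb what remains. For \<open>r = 1\<close> the
  tail is empty.\<close>

lemma weighted_cross_sum_le:
  fixes s t \<Lambda> :: "nat \<Rightarrow> real"
  assumes "r \<ge> 1" "0 \<le> \<Lambda> 0" "0 \<le> l"
    and \<Lambda>: "\<And>i. 0 < i \<Longrightarrow> i < r \<Longrightarrow> 0 \<le> \<Lambda> i \<and> \<Lambda> i \<le> l"
    and A: "(\<Sum>i<r. (s i)\<^sup>2) \<le> A" and B: "(\<Sum>i<r. (t i)\<^sup>2) \<le> B"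
  shows "2 * (\<Sum>i<r. \<Lambda> i * s i * t i)
    \<le> \<Lambda> 0 * ((s 0)\<^sup>2 + (t 0)\<^sup>2) + l * (A - (s 0)\<^sup>2 + B - (t 0)\<^sup>2)"
proof -
  have am_gm: "2 * (c * x * y) \<le> c * (x\<^sup>2 + y\<^sup>2)" if "0 \<le> c" for c x y :: real
    using mult_left_mono[OF sum_squares_bound[of x y] that] by (simp add: mult_ac)
  have le: "2 * (\<Lambda> i * s i * t i) \<le> l * ((s i)\<^sup>2 + (t i)\<^sup>2)" if "i \<in> {1..<r}" for i
    using am_gm[of "\<Lambda> i" "s i" "t i"] mult_right_mono[of "\<Lambda> i" l "(s i)\<^sup>2 + (t i)\<^sup>2"] \<Lambda>[of i] that
    by fastforce
  have split: "(\<Sum>i<r. f i) = f 0 + (\<Sum>i\<in>{1..<r}. f i)" for f :: "nat \<Rightarrow> real"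
    using \<open>r \<ge> 1\<close> by (simp add: sum.atLeast_Suc_lessThan flip: atLeast0LessThan)
  have "2 * (\<Sum>i<r. \<Lambda> i * s i * t i) = 2 * (\<Lambda> 0 * s 0 * t 0) + (\<Sum>i\<in>{1..<r}. 2 * (\<Lambda> i * s i * t i))"
    by (simp add: split sum_distrib_left distrib_left)
  also have "\<dots> \<le> \<Lambda> 0 * ((s 0)\<^sup>2 + (t 0)\<^sup>2) + (\<Sum>i\<in>{1..<r}. l * ((s i)\<^sup>2 + (t i)\<^sup>2))"
    using am_gm \<open>0 \<le> \<Lambda> 0\<close> le by (intro add_mono sum_mono) auto
  also have "(\<Sum>i\<in>{1..<r}. l * ((s i)\<^sup>2 + (t i)\<^sup>2)) =
      l * ((\<Sum>i\<in>{1..<r}. (s i)\<^sup>2) + (\<Sum>i\<in>{1..<r}. (t i)\<^sup>2))"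
    by (simp add: sum_distrib_left sum.distrib distrib_left)
  also have "\<dots> \<le> l * (A - (s 0)\<^sup>2 + B - (t 0)\<^sup>2)"
    using A B \<open>0 \<le> l\<close> by (intro mult_left_mono) (auto simp: split)
  finally show ?thesis by simp
qed

section \<open>Symmetry and quadratic form of the Hessian matrix\<close>

lemma transpose_hessian_H0:
  assumes \<Sigma>x: "\<Sigma>x \<in> carrier_mat p p" "\<Sigma>x\<^sup>T = \<Sigma>x" and \<Sigma>y: "\<Sigma>y \<in> carrier_mat q q" "\<Sigma>y\<^sup>T = \<Sigma>y"
    and \<Sigma>xy: "\<Sigma>xy \<in> carrier_mat p q"
    and \<alpha>: "\<alpha> \<in> carrier_vec p" and \<beta>: "\<beta> \<in> carrier_vec q"
  shows "(hessian_H0 \<Sigma>x \<Sigma>xy \<Sigma>xy\<^sup>T \<Sigma>y \<rho> \<alpha> \<beta>)\<^sup>T = hessian_H0 \<Sigma>x \<Sigma>xy \<Sigma>xy\<^sup>T \<Sigma>y \<rho> \<alpha> \<beta>"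
proof -
  have sym: "(S + 2 \<cdot>\<^sub>m (S * outer_prod x x * S))\<^sup>T = S + 2 \<cdot>\<^sub>m (S * outer_prod x x * S)"
    if S: "S \<in> carrier_mat n n" "S\<^sup>T = S" and x: "x \<in> carrier_vec n" for S :: "real mat" and x n
  proof -
    have O: "outer_prod x x \<in> carrier_mat n n" "(outer_prod x x)\<^sup>T = outer_prod x x"
      using x by (auto simp: outer_prod_def intro!: eq_matI)
    have "(S * outer_prod x x * S)\<^sup>T = S\<^sup>T * ((outer_prod x x)\<^sup>T * S\<^sup>T)"
      using S(1) O(1) by (simp add: transpose_mult[of _ n n _ n])
    then have "(S * outer_prod x x * S)\<^sup>T = S * outer_prod x x * S"
      using S O by (simp add: assoc_mult_mat[of _ n n _ n _ n])
    moreover have "(2 \<cdot>\<^sub>m (S * outer_prod x x * S))\<^sup>T = 2 \<cdot>\<^sub>m (S * outer_prod x x * S)\<^sup>T"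
      by (intro eq_matI) auto
    ultimately show ?thesis
      using S O by (simp add: transpose_add[of _ n n])
  qed
  have off: "(- ((1 / \<rho>) \<cdot>\<^sub>m M))\<^sup>T = - ((1 / \<rho>) \<cdot>\<^sub>m M\<^sup>T)" for M :: "real mat"
    by (intro eq_matI) auto
  have smult: "(c \<cdot>\<^sub>m M)\<^sup>T = c \<cdot>\<^sub>m M\<^sup>T" for c and M :: "real mat"
    by (intro eq_matI) auto
  \<comment> \<open>Transposition swaps the two off-diagonal blocks, which are transposes of each
    other because the lower left one is built from \<open>\<Sigma>xy\<^sup>T\<close>.\<close>
  show ?thesis
    unfolding hessian_H0_def smult
    by (subst transpose_four_block_mat[of _ p p _ q _ q])
      (use assms in \<open>simp_all add: conjugated_outer_prod_carrier_mat off sym[of _ p] sym[of _ q]\<close>)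
qed

text \<open>The outer factor \<open>2 * \<rho>\<close> cancels the \<open>1 / \<rho>\<close> in the
  off-diagonal blocks. These two blocks contribute equally, which gives the coefficient 4 of the
  cross term.\<close>

lemma hessian_H0_quadratic_form:
  assumes \<Sigma>x: "\<Sigma>x \<in> carrier_mat p p" "\<Sigma>x\<^sup>T = \<Sigma>x" and \<Sigma>y: "\<Sigma>y \<in> carrier_mat q q" "\<Sigma>y\<^sup>T = \<Sigma>y"
    and \<Sigma>xy: "\<Sigma>xy \<in> carrier_mat p q"
    and \<alpha>: "\<alpha> \<in> carrier_vec p" and \<beta>: "\<beta> \<in> carrier_vec q" and \<rho>: "\<rho> \<noteq> 0"
    and a: "a \<in> carrier_vec p" and b: "b \<in> carrier_vec q"
  shows "(a @\<^sub>v b) \<bullet> (hessian_H0 \<Sigma>x \<Sigma>xy \<Sigma>xy\<^sup>T \<Sigma>y \<rho> \<alpha> \<beta> *\<^sub>v (a @\<^sub>v b)) =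
    2 * \<rho> * (a \<bullet> (\<Sigma>x *\<^sub>v a) + 2 * (\<alpha> \<bullet> (\<Sigma>x *\<^sub>v a))\<^sup>2 + b \<bullet> (\<Sigma>y *\<^sub>v b) + 2 * (\<beta> \<bullet> (\<Sigma>y *\<^sub>v b))\<^sup>2)
    - 4 * (a \<bullet> (\<Sigma>xy *\<^sub>v b))"
proof -
  have diag: "x \<bullet> ((S + 2 \<cdot>\<^sub>m (S * outer_prod z z * S)) *\<^sub>v x) = x \<bullet> (S *\<^sub>v x) + 2 * (z \<bullet> (S *\<^sub>v x))\<^sup>2"
    if S: "S \<in> carrier_mat n n" "S\<^sup>T = S" and z: "z \<in> carrier_vec n" and x: "x \<in> carrier_vec n"
    for S :: "real mat" and x z n
  proof -
    define W where "W = S * outer_prod z z * S"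
    have W: "W \<in> carrier_mat n n" using S z by (simp add: W_def conjugated_outer_prod_carrier_mat)
    have "(S + 2 \<cdot>\<^sub>m W) *\<^sub>v x = S *\<^sub>v x + 2 \<cdot>\<^sub>v (W *\<^sub>v x)"
      using S W x by (simp add: add_mult_distrib_mat_vec[of _ n n] smult_mat_mult_vec[of _ n n])
    then show ?thesis
      using S W x outer_prod_quadratic_form[OF S z x]
      by (simp add: scalar_prod_add_distrib[of _ n] flip: W_def)
  qed
  have off: "x \<bullet> (- ((1 / \<rho>) \<cdot>\<^sub>m M) *\<^sub>v y) = - (x \<bullet> (M *\<^sub>v y)) / \<rho>"
    if "M \<in> carrier_mat m n" "x \<in> carrier_vec m" "y \<in> carrier_vec n" for M :: "real mat" and x y m n
    using that by (simp add: smult_mat_mult_vec[of _ m n])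
  define D1 where "D1 = \<Sigma>x + 2 \<cdot>\<^sub>m (\<Sigma>x * outer_prod \<alpha> \<alpha> * \<Sigma>x)"
  define D2 where "D2 = \<Sigma>y + 2 \<cdot>\<^sub>m (\<Sigma>y * outer_prod \<beta> \<beta> * \<Sigma>y)"
  define N where "N = - ((1 / \<rho>) \<cdot>\<^sub>m \<Sigma>xy)"
  define N' where "N' = - ((1 / \<rho>) \<cdot>\<^sub>m \<Sigma>xy\<^sup>T)"
  have D1: "D1 \<in> carrier_mat p p" and D2: "D2 \<in> carrier_mat q q"
    and N: "N \<in> carrier_mat p q" and N': "N' \<in> carrier_mat q p"
    using assms by (simp_all add: D1_def D2_def N_def N'_def conjugated_outer_prod_carrier_mat)
  have "\<Sigma>xy\<^sup>T *\<^sub>v a \<in> carrier_vec q"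
    using \<Sigma>xy by (intro carrier_vecI) simp
  then have adj: "b \<bullet> (\<Sigma>xy\<^sup>T *\<^sub>v a) = a \<bullet> (\<Sigma>xy *\<^sub>v b)"
    using transpose_vec_mult_scalar[OF \<Sigma>xy b a] comm_scalar_prod[of b q "\<Sigma>xy\<^sup>T *\<^sub>v a"] b by simp
  have H: "hessian_H0 \<Sigma>x \<Sigma>xy \<Sigma>xy\<^sup>T \<Sigma>y \<rho> \<alpha> \<beta> *\<^sub>v (a @\<^sub>v b) =
      (2 * \<rho>) \<cdot>\<^sub>v ((D1 *\<^sub>v a + N *\<^sub>v b) @\<^sub>v (N' *\<^sub>v a + D2 *\<^sub>v b))"
    unfolding hessian_H0_def D1_def[symmetric] D2_def[symmetric] N_def[symmetric] N'_def[symmetric]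
    using smult_mat_mult_vec[OF four_block_carrier_mat[OF D1 D2], of "a @\<^sub>v b"]
      four_block_mat_mult_vec[OF D1 N N' D2 a b] a b by simp
  have blocks: "(a @\<^sub>v b) \<bullet> ((D1 *\<^sub>v a + N *\<^sub>v b) @\<^sub>v (N' *\<^sub>v a + D2 *\<^sub>v b)) =
      a \<bullet> (D1 *\<^sub>v a) + a \<bullet> (N *\<^sub>v b) + (b \<bullet> (N' *\<^sub>v a) + b \<bullet> (D2 *\<^sub>v b))"
    using a b D1 D2 N N'
    by (simp add: scalar_prod_append[of _ p _ q] scalar_prod_add_distrib[of _ p] scalar_prod_add_distrib[of _ q])
  have entries: "a \<bullet> (D1 *\<^sub>v a) = a \<bullet> (\<Sigma>x *\<^sub>v a) + 2 * (\<alpha> \<bullet> (\<Sigma>x *\<^sub>v a))\<^sup>2"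
    "b \<bullet> (D2 *\<^sub>v b) = b \<bullet> (\<Sigma>y *\<^sub>v b) + 2 * (\<beta> \<bullet> (\<Sigma>y *\<^sub>v b))\<^sup>2"
    "a \<bullet> (N *\<^sub>v b) = - (a \<bullet> (\<Sigma>xy *\<^sub>v b)) / \<rho>" "b \<bullet> (N' *\<^sub>v a) = - (b \<bullet> (\<Sigma>xy\<^sup>T *\<^sub>v a)) / \<rho>"
    unfolding D1_def D2_def N_def N'_def using off[OF \<Sigma>xy a b] off[OF transpose_carrier_mat[THEN iffD2, OF \<Sigma>xy] b a]
      diag[OF \<Sigma>x \<alpha> a] diag[OF \<Sigma>y \<beta> b] by simp_all
  have "(a @\<^sub>v b) \<bullet> (hessian_H0 \<Sigma>x \<Sigma>xy \<Sigma>xy\<^sup>T \<Sigma>y \<rho> \<alpha> \<beta> *\<^sub>v (a @\<^sub>v b)) =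
      2 * \<rho> * ((a @\<^sub>v b) \<bullet> ((D1 *\<^sub>v a + N *\<^sub>v b) @\<^sub>v (N' *\<^sub>v a + D2 *\<^sub>v b)))"
    unfolding H using a b D2 N' by (intro scalar_prod_smult_right) (simp add: D1 carrier_matD[OF N])
  also have "\<dots> = 2 * \<rho> * (a \<bullet> (\<Sigma>x *\<^sub>v a) + 2 * (\<alpha> \<bullet> (\<Sigma>x *\<^sub>v a))\<^sup>2
      + b \<bullet> (\<Sigma>y *\<^sub>v b) + 2 * (\<beta> \<bullet> (\<Sigma>y *\<^sub>v b))\<^sup>2) - 4 * (a \<bullet> (\<Sigma>xy *\<^sub>v b))"
    unfolding blocks entries adj using \<rho> by (simp add: field_simps)
  finally show ?thesis .
qed

section \<open>Symmetry of the covariance blocks, and the eigenvalue bound\<close>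

lemma transpose_covariance_mat: "(covariance_mat P n Z)\<^sup>T = covariance_mat P n Z"
  by (intro eq_matI) (auto simp: covariance_mat_def mult.commute)

text \<open>Serves to derive the symmetry of \<Sigma>x and \<Sigma>y from that of the joint
  covariance matrix.\<close>

lemma symmetric_four_block_diag:
  assumes "A \<in> carrier_mat p p" "B \<in> carrier_mat p q" "C \<in> carrier_mat q p" "D \<in> carrier_mat q q"
    and "(four_block_mat A B C D)\<^sup>T = four_block_mat A B C D"
  shows "A\<^sup>T = A" "D\<^sup>T = D"
proof -
  have "four_block_mat A\<^sup>T C\<^sup>T B\<^sup>T D\<^sup>T = four_block_mat A B C D"
    using assms transpose_four_block_mat[of A p p B q C q D] by simp
  then have entry: "four_block_mat A\<^sup>T C\<^sup>T B\<^sup>T D\<^sup>T $$ (i, j) = four_block_mat A B C D $$ (i, j)" for i j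
    by simp
  show "A\<^sup>T = A"
  proof (rule eq_matI)
    fix i j assume "i < dim_row A" "j < dim_col A"
    then show "A\<^sup>T $$ (i, j) = A $$ (i, j)"
      using entry[of i j] assms(1-4) by simp
  qed (use assms(1) in auto)
  show "D\<^sup>T = D"
  proof (rule eq_matI)
    fix i j assume "i < dim_row D" "j < dim_col D"
    then show "D\<^sup>T $$ (i, j) = D $$ (i, j)"
      using entry[of "p + i" "p + j"] assms(1-4) by simp
  qed (use assms(4) in auto)
qed

theorem lemma2:
  fixes P :: "'a measure"
    and X Y :: "'a \<Rightarrow> real vec"
    and p q r :: nat
    and \<Sigma>x \<Sigma>xy \<Sigma>yx \<Sigma>y U V :: "real mat"
    and \<Lambda> :: "nat \<Rightarrow> real"
    and \<rho>0 \<Lambda>2 \<epsilon>0 M :: real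
    and \<alpha>0 \<beta>0 :: "real vec"
  assumes "prob_space P"
    and "random_vector P p X" and "mean_vec P p X = 0\<^sub>v p"
    and "random_vector P q Y" and "mean_vec P q Y = 0\<^sub>v q"
    and "\<Sigma>x \<in> carrier_mat p p" and "\<Sigma>xy \<in> carrier_mat p q"
    and "\<Sigma>yx \<in> carrier_mat q p" and "\<Sigma>y \<in> carrier_mat q q"
    and "covariance_mat P (p + q) (\<lambda>\<omega>. X \<omega> @\<^sub>v Y \<omega>) = four_block_mat \<Sigma>x \<Sigma>xy \<Sigma>yx \<Sigma>y"
    and "\<Sigma>yx = \<Sigma>xy\<^sup>T"
    and "vec_space.rank p \<Sigma>xy = r" and "r \<ge> 1"
    and "U \<in> carrier_mat p r" and "V \<in> carrier_mat q r"
    and "\<Sigma>xy = \<Sigma>x * U * mat_diag r \<Lambda> * V\<^sup>T * \<Sigma>y"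
    and "U\<^sup>T * \<Sigma>x * U = 1\<^sub>m r" and "V\<^sup>T * \<Sigma>y * V = 1\<^sub>m r"
    and "\<forall>i j. i \<le> j \<and> j < r \<longrightarrow> \<Lambda> j \<le> \<Lambda> i" and "\<forall>i<r. 0 < \<Lambda> i"
    and "\<rho>0 = \<Lambda> 0" and "\<alpha>0 = col U 0" and "\<beta>0 = col V 0"
    and "\<Lambda>2 = (if r = 1 then 0 else \<Lambda> 1)"
    and "0 < \<epsilon>0" and "\<epsilon>0 < 1" and "\<rho>0 - \<Lambda>2 > \<epsilon>0"
    and "0 < M"
    and "spectrum \<Sigma>x \<subseteq> {inverse M..M}" and "spectrum \<Sigma>y \<subseteq> {inverse M..M}"
  shows "positive_definite (hessian_H0 \<Sigma>x \<Sigma>xy \<Sigma>yx \<Sigma>y \<rho>0 \<alpha>0 \<beta>0)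
    \<and> min_eigenvalue (hessian_H0 \<Sigma>x \<Sigma>xy \<Sigma>yx \<Sigma>y \<rho>0 \<alpha>0 \<beta>0) \<ge> 2 * (\<rho>0 - \<Lambda>2) / M"
proof -
  note \<Sigma>x = \<open>\<Sigma>x \<in> carrier_mat p p\<close> and \<Sigma>y = \<open>\<Sigma>y \<in> carrier_mat q q\<close>
    and \<Sigma>xy = \<open>\<Sigma>xy \<in> carrier_mat p q\<close> and U = \<open>U \<in> carrier_mat p r\<close> and V = \<open>V \<in> carrier_mat q r\<close>
  note orthU = \<open>U\<^sup>T * \<Sigma>x * U = 1\<^sub>m r\<close> and orthV = \<open>V\<^sup>T * \<Sigma>y * V = 1\<^sub>m r\<close>
  note specx = \<open>spectrum \<Sigma>x \<subseteq> {inverse M..M}\<close> and specy = \<open>spectrum \<Sigma>y \<subseteq> {inverse M..M}\<close>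
  have "(four_block_mat \<Sigma>x \<Sigma>xy \<Sigma>yx \<Sigma>y)\<^sup>T = four_block_mat \<Sigma>x \<Sigma>xy \<Sigma>yx \<Sigma>y"
    using transpose_covariance_mat[of P "p + q" "\<lambda>\<omega>. X \<omega> @\<^sub>v Y \<omega>"] assms(10) by simp
  then have symx: "\<Sigma>x\<^sup>T = \<Sigma>x" and symy: "\<Sigma>y\<^sup>T = \<Sigma>y"
    using symmetric_four_block_diag[OF \<Sigma>x \<Sigma>xy \<open>\<Sigma>yx \<in> carrier_mat q p\<close> \<Sigma>y] by auto
  have pos: "0 < \<Lambda> i" if "i < r" for i
    using that assms(20) by blast
  have "0 < \<rho>0" using pos[of 0] \<open>r \<ge> 1\<close> \<open>\<rho>0 = \<Lambda> 0\<close> by simp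
  have "0 \<le> \<Lambda>2" using pos[of 1] \<open>r \<ge> 1\<close> assms(24) by (cases "r = 1") auto
  \<comment> \<open>Indices start at 0, so \<open>\<Lambda> 1\<close> is the second canonical
    correlation and dominates all later ones. For \<open>r = 1\<close> no index qualifies.\<close>
  have \<Lambda>_le: "0 \<le> \<Lambda> i \<and> \<Lambda> i \<le> \<Lambda>2" if "0 < i" "i < r" for i
    using pos[of i] assms(19,24) that by auto
  have "0 < \<rho>0 - \<Lambda>2" using \<open>0 < \<epsilon>0\<close> \<open>\<rho>0 - \<Lambda>2 > \<epsilon>0\<close> by simp
  have \<alpha>: "\<alpha>0 \<in> carrier_vec p" and \<beta>: "\<beta>0 \<in> carrier_vec q"
    unfolding \<open>\<alpha>0 = col U 0\<close> \<open>\<beta>0 = col V 0\<close> using U V by (auto intro: carrier_vecI)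

  have gex: "inverse M * (a \<bullet> a) \<le> a \<bullet> (\<Sigma>x *\<^sub>v a)" if "a \<in> carrier_vec p" for a
    by (rule symmetric_quadratic_form_ge[OF \<Sigma>x symx _ that]) (use specx in auto)
  have gey: "inverse M * (b \<bullet> b) \<le> b \<bullet> (\<Sigma>y *\<^sub>v b)" if "b \<in> carrier_vec q" for b
    by (rule symmetric_quadratic_form_ge[OF \<Sigma>y symy _ that]) (use specy in auto)
  have psdx: "0 \<le> a \<bullet> (\<Sigma>x *\<^sub>v a)" if "a \<in> carrier_vec p" for a
    using order_trans[OF _ gex[OF that], of 0] \<open>0 < M\<close> scalar_prod_self_nonneg[of a] by simp
  have psdy: "0 \<le> b \<bullet> (\<Sigma>y *\<^sub>v b)" if "b \<in> carrier_vec q" for b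
    using order_trans[OF _ gey[OF that], of 0] \<open>0 < M\<close> scalar_prod_self_nonneg[of b] by simp

  define H where "H = hessian_H0 \<Sigma>x \<Sigma>xy \<Sigma>yx \<Sigma>y \<rho>0 \<alpha>0 \<beta>0"
  have H: "H \<in> carrier_mat (p + q) (p + q)"
    using \<Sigma>x \<Sigma>y \<alpha> \<beta> by (simp add: H_def hessian_H0_def conjugated_outer_prod_carrier_mat)
  have symH: "H\<^sup>T = H"
    unfolding H_def \<open>\<Sigma>yx = \<Sigma>xy\<^sup>T\<close> by (rule transpose_hessian_H0[OF \<Sigma>x symx \<Sigma>y symy \<Sigma>xy \<alpha> \<beta>])
  \<comment> \<open>Ensures that \<open>H\<close> has positive dimension and hence an eigenvalue.
    With \<open>p = 0\<close> the entries of \<open>U\<^sup>T * \<Sigma>x * U\<close> would be empty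
    sums, contradicting orthonormality with \<open>r \<ge> 1\<close>.\<close>
  have "p \<noteq> 0"
  proof
    assume "p = 0"
    then have "(U\<^sup>T * \<Sigma>x * U) $$ (0, 0) = 0"
      using U \<Sigma>x \<open>r \<ge> 1\<close> by (simp add: scalar_prod_def)
    then show False using orthU \<open>r \<ge> 1\<close> by simp
  qed
  have ge: "2 * (\<rho>0 - \<Lambda>2) / M * (v \<bullet> v) \<le> v \<bullet> (H *\<^sub>v v)" if v: "v \<in> carrier_vec (p + q)" for v
  proof -
    define a b where "a = vec_first v p" and "b = vec_last v q"
    have a: "a \<in> carrier_vec p" and b: "b \<in> carrier_vec q" and ab: "v = a @\<^sub>v b"
      using v by (simp_all add: a_def b_def)
    define A B where "A = a \<bullet> (\<Sigma>x *\<^sub>v a)" and "B = b \<bullet> (\<Sigma>y *\<^sub>v b)"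
    define s t where "s i = col U i \<bullet> (\<Sigma>x *\<^sub>v a)" and "t i = col V i \<bullet> (\<Sigma>y *\<^sub>v b)" for i
    have cross: "a \<bullet> (\<Sigma>xy *\<^sub>v b) = (\<Sum>i<r. \<Lambda> i * s i * t i)"
      unfolding s_def t_def assms(16)
      by (rule canonical_decomposition_bilinear_form[OF \<Sigma>x symx \<Sigma>y U V a b])
    have "(\<Sum>i<r. (s i)\<^sup>2) \<le> A" "(\<Sum>i<r. (t i)\<^sup>2) \<le> B"
      unfolding s_def t_def A_def B_def
      using weighted_Bessel[OF \<Sigma>x symx psdx U orthU a] weighted_Bessel[OF \<Sigma>y symy psdy V orthV b]
      by auto
    then have "2 * (\<Sum>i<r. \<Lambda> i * s i * t i)
        \<le> \<rho>0 * ((s 0)\<^sup>2 + (t 0)\<^sup>2) + \<Lambda>2 * (A - (s 0)\<^sup>2 + B - (t 0)\<^sup>2)"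
      unfolding \<open>\<rho>0 = \<Lambda> 0\<close>
      using \<open>0 < \<rho>0\<close> \<open>\<rho>0 = \<Lambda> 0\<close> \<open>0 \<le> \<Lambda>2\<close> \<Lambda>_le \<open>r \<ge> 1\<close> by (intro weighted_cross_sum_le) auto
    \<comment> \<open>After the cross sum is bounded, the form exceeds
      \<open>2 * (\<rho>0 - \<Lambda>2) * (A + B)\<close> by at least
      \<open>2 * (\<rho>0 + \<Lambda>2) * ((s 0)\<^sup>2 + (t 0)\<^sup>2)\<close>. These two facts
      allow that surplus to be dropped.\<close>
    moreover have "0 \<le> \<Lambda>2 * ((s 0)\<^sup>2 + (t 0)\<^sup>2)" "0 \<le> \<rho>0 * ((s 0)\<^sup>2 + (t 0)\<^sup>2)"
      using \<open>0 \<le> \<Lambda>2\<close> \<open>0 < \<rho>0\<close> by simp_all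
    moreover have "v \<bullet> (H *\<^sub>v v) = 2 * \<rho>0 * (A + 2 * (s 0)\<^sup>2 + B + 2 * (t 0)\<^sup>2)
        - 4 * (\<Sum>i<r. \<Lambda> i * s i * t i)"
      using hessian_H0_quadratic_form[OF \<Sigma>x symx \<Sigma>y symy \<Sigma>xy \<alpha> \<beta> _ a b, of \<rho>0] \<open>0 < \<rho>0\<close>
      by (simp add: H_def ab A_def B_def s_def t_def \<open>\<Sigma>yx = \<Sigma>xy\<^sup>T\<close> \<open>\<alpha>0 = col U 0\<close> \<open>\<beta>0 = col V 0\<close>
          cross[unfolded s_def t_def])
    ultimately have "2 * (\<rho>0 - \<Lambda>2) * (A + B) \<le> v \<bullet> (H *\<^sub>v v)"
      by (simp add: algebra_simps)
    moreover have "v \<bullet> v = a \<bullet> a + b \<bullet> b"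
      unfolding ab by (rule scalar_prod_append[OF a b a b])
    then have "inverse M * (v \<bullet> v) \<le> A + B"
      using gex[OF a] gey[OF b] by (simp add: A_def B_def distrib_left)
    then have "2 * (\<rho>0 - \<Lambda>2) * (inverse M * (v \<bullet> v)) \<le> 2 * (\<rho>0 - \<Lambda>2) * (A + B)"
      using \<open>0 < \<rho>0 - \<Lambda>2\<close> by (intro mult_left_mono) auto
    ultimately show ?thesis by (simp add: field_simps)
  qed
  have "0 < 2 * (\<rho>0 - \<Lambda>2) / M"
    using \<open>0 < \<rho>0 - \<Lambda>2\<close> \<open>0 < M\<close> by simp
  \<comment> \<open>The single coercivity estimate \<open>ge\<close> yields both conclusions: its
    constant is positive and also bounds every eigenvalue from below.\<close>
  then show ?thesis
    using positive_definite_if_coercive[OF H symH _ ge] symmetric_min_eigenvalue_ge[OF H symH _ ge]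
      \<open>p \<noteq> 0\<close> by (simp add: H_def)
qed

end
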